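(* Let $\alpha,\beta,\sigma$, $\eta=\alpha\beta$, $\mathcal F_{\alpha,\beta,\sigma}$ and $\mathbb F_{\eta,\sigma}(\mathbb C)$ be as in the context, and let $\mathbb T:\mathcal F_{\alpha,\beta,\sigma}\to\mathbb F_{\eta,\sigma}(\mathbb C)$ be the unitary operator satisfying $(\mathbb T(\cdot\mid\beta)_n)(z)=z^n$ for all $n\in\mathbb N_0$. Then for each $f\in\mathcal F_{\alpha,\beta,\sigma}$ and $z\in\mathbb C$, $$(\mathbb Tf)(z)=\int_{\mathbb N_0}f(\beta\xi)\,\pi_{\frac z\beta}(d\xi).$$
   Context: $\mathbb N_0=\{0,1,2,\dots\}$; $(z\mid h)_0=1$, $(z\mid h)_n=z(z-h)\cdots(z-(n-1)h)$. For $\zeta\in\mathbb C$, $\pi_\zeta=e^{-\zeta}\sum_{n\ge0}\frac{\zeta^n}{n!}\delta_n$ (complex-valued Poisson measure on $\mathbb N_0$). Parameters: $\sigma>0$, and $\alpha,\beta\in\mathbb C$ satisfy either $\alpha\ge\beta>0$, or $\Re(\alpha)\ge0$, $\Im(\alpha)>0$, $\beta=\overline\alpha$; $\eta=\alpha\beta>0$. $\mathcal D_{\alpha,\beta,\sigma}=\{z\in\mathbb C\mid\Re(\alpha z)>-\sigma/2\}$ if $|\alpha|=|\beta|$, and $\mathcal D_{\alpha,\beta,\sigma}=\mathbb C$ if $\alpha>\beta>0$ (so $\beta\mathbb N_0\subset\mathcal D_{\alpha,\beta,\sigma}$). $\mathcal F_{\alpha,\beta,\sigma}$ is the Hilbert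 space of holomorphic functions on $\mathcal D_{\alpha,\beta,\sigma}$ of the form $\varphi(z)=\sum_nf_n(z\mid\beta)_n$ with $\sum_n|f_n|^2n!\,(\sigma\mid-\eta)_n<\infty$ (such series converge locally uniformly on $\mathcal D_{\alpha,\beta,\sigma}$ and the $f_n$ are unique), with inner product $(\varphi,\psi)=\sum_nf_n\overline{g_n}\,n!\,(\sigma\mid-\eta)_n$ for $\psi(z)=\sum_ng_n(z\mid\beta)_n$. $\mathbb F_{\eta,\sigma}(\mathbb C)$ is the Hilbert space of entire functions $\varphi(z)=\sum_nf_nz^n$ with $\sum_n|f_n|^2n!\,(\sigma\mid-\eta)_n<\infty$ and inner product $\sum_nf_n\overline{g_n}\,n!\,(\sigma\mid-\eta)_n$. *)

theory Defs
  imports "HOL-Analysis.Analysis"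
begin

text \<open>The generalized falling factorial \<open>(z | h)\<^sub>n = z (z - h) \<dots> (z - (n - 1) h)\<close>.\<close>

definition gen_ffact :: "'a::comm_ring_1 \<Rightarrow> 'a \<Rightarrow> nat \<Rightarrow> 'a" where
  "gen_ffact z h n = (\<Prod>k<n. z - of_nat k * h)"

definition admissible :: "complex \<Rightarrow> complex \<Rightarrow> real \<Rightarrow> bool" where
  "admissible \<alpha> \<beta> \<sigma> \<longleftrightarrow> \<sigma> > 0 \<and>
     (\<alpha> \<in> \<real> \<and> \<beta> \<in> \<real> \<and> Re \<alpha> \<ge> Re \<beta> \<and> Re \<beta> > 0 \<or>
      Re \<alpha> \<ge> 0 \<and> Im \<alpha> > 0 \<and> \<beta> = cnj \<alpha>)"

text \<open>For admissible parameters \<open>\<alpha> * \<beta>\<close> is real and positive, so taking the real part only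
  changes the type.\<close>

definition eta :: "complex \<Rightarrow> complex \<Rightarrow> real" where
  "eta \<alpha> \<beta> = Re (\<alpha> * \<beta>)"

definition weight :: "real \<Rightarrow> real \<Rightarrow> nat \<Rightarrow> real" where
  "weight \<eta> \<sigma> n = fact n * gen_ffact \<sigma> (- \<eta>) n"

text \<open>A function on a domain \<open>D\<close> is represented by its extension by zero to the whole plane.
  Then functions are equal iff they agree on \<open>D\<close>, and the vector space operations are the
  pointwise ones.\<close>

definition zero_ext :: "complex set \<Rightarrow> (complex \<Rightarrow> complex) \<Rightarrow> complex \<Rightarrow> complex" where
  "zero_ext D \<phi> = (\<lambda>z. if z \<in> D then \<phi> z else 0)"

text \<open>Both Hilbert spaces consist of holomorphic functions \<open>\<Sum>n. f n * e n z\<close> on a domain \<open>D\<close>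
  with \<open>f\<close> in a weighted \<open>\<ell>\<^sup>2\<close> space.\<close>

definition has_expansion ::
  "complex set \<Rightarrow> (nat \<Rightarrow> complex \<Rightarrow> complex) \<Rightarrow> (nat \<Rightarrow> real) \<Rightarrow>
   (complex \<Rightarrow> complex) \<Rightarrow> (nat \<Rightarrow> complex) \<Rightarrow> bool" where
  "has_expansion D e w \<phi> f \<longleftrightarrow>
     summable (\<lambda>n. (cmod (f n))\<^sup>2 * w n) \<and> (\<forall>z\<in>D. (\<lambda>n. f n * e n z) sums \<phi> z)"

definition expansion_space ::
  "complex set \<Rightarrow> (nat \<Rightarrow> complex \<Rightarrow> complex) \<Rightarrow> (nat \<Rightarrow> real) \<Rightarrow> (complex \<Rightarrow> complex) set" where
  "expansion_space D e w =
     {\<phi>. \<phi> holomorphic_on D \<and> (\<forall>z. z \<notin> D \<longrightarrow> \<phi> z = 0) \<and> (\<exists>f. has_expansion D e w \<phi> f)}"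

text \<open>The coefficients are unique for both bases used below, so the definite description is
  meaningful there.\<close>

definition expansion_coeff ::
  "complex set \<Rightarrow> (nat \<Rightarrow> complex \<Rightarrow> complex) \<Rightarrow> (nat \<Rightarrow> real) \<Rightarrow>
   (complex \<Rightarrow> complex) \<Rightarrow> nat \<Rightarrow> complex" where
  "expansion_coeff D e w \<phi> = (THE f. has_expansion D e w \<phi> f)"

definition expansion_inner ::
  "complex set \<Rightarrow> (nat \<Rightarrow> complex \<Rightarrow> complex) \<Rightarrow> (nat \<Rightarrow> real) \<Rightarrow>
   (complex \<Rightarrow> complex) \<Rightarrow> (complex \<Rightarrow> complex) \<Rightarrow> complex" where
  "expansion_inner D e w \<phi> \<psi> =
     (\<Sum>n. expansion_coeff D e w \<phi> n * cnj (expansion_coeff D e w \<psi> n) * of_real (w n))"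

definition D_dom :: "complex \<Rightarrow> complex \<Rightarrow> real \<Rightarrow> complex set" where
  "D_dom \<alpha> \<beta> \<sigma> = (if cmod \<alpha> = cmod \<beta> then {z. Re (\<alpha> * z) > - \<sigma> / 2} else UNIV)"

definition F_space :: "complex \<Rightarrow> complex \<Rightarrow> real \<Rightarrow> (complex \<Rightarrow> complex) set" where
  "F_space \<alpha> \<beta> \<sigma> =
     expansion_space (D_dom \<alpha> \<beta> \<sigma>) (\<lambda>n z. gen_ffact z \<beta> n) (weight (eta \<alpha> \<beta>) \<sigma>)"

definition F_inner ::
  "complex \<Rightarrow> complex \<Rightarrow> real \<Rightarrow> (complex \<Rightarrow> complex) \<Rightarrow> (complex \<Rightarrow> complex) \<Rightarrow> complex" where
  "F_inner \<alpha> \<beta> \<sigma> =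
     expansion_inner (D_dom \<alpha> \<beta> \<sigma>) (\<lambda>n z. gen_ffact z \<beta> n) (weight (eta \<alpha> \<beta>) \<sigma>)"

definition Fock_space :: "real \<Rightarrow> real \<Rightarrow> (complex \<Rightarrow> complex) set" where
  "Fock_space \<eta> \<sigma> = expansion_space UNIV (\<lambda>n z. z ^ n) (weight \<eta> \<sigma>)"

definition Fock_inner ::
  "real \<Rightarrow> real \<Rightarrow> (complex \<Rightarrow> complex) \<Rightarrow> (complex \<Rightarrow> complex) \<Rightarrow> complex" where
  "Fock_inner \<eta> \<sigma> = expansion_inner UNIV (\<lambda>n z. z ^ n) (weight \<eta> \<sigma>)"

text \<open>A unitary operator is a linear surjection preserving the inner product. The values of \<open>T\<close>
  outside \<open>V\<close> are irrelevant.\<close>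

definition unitary_operator ::
  "(complex \<Rightarrow> complex) set \<Rightarrow> ((complex \<Rightarrow> complex) \<Rightarrow> (complex \<Rightarrow> complex) \<Rightarrow> complex) \<Rightarrow>
   (complex \<Rightarrow> complex) set \<Rightarrow> ((complex \<Rightarrow> complex) \<Rightarrow> (complex \<Rightarrow> complex) \<Rightarrow> complex) \<Rightarrow>
   ((complex \<Rightarrow> complex) \<Rightarrow> complex \<Rightarrow> complex) \<Rightarrow> bool" where
  "unitary_operator V ipV W ipW T \<longleftrightarrow>
     T ` V = W \<and>
     (\<forall>\<phi>\<in>V. \<forall>\<psi>\<in>V. T (\<lambda>z. \<phi> z + \<psi> z) = (\<lambda>z. T \<phi> z + T \<psi> z)) \<and>
     (\<forall>c. \<forall>\<phi>\<in>V. T (\<lambda>z. c * \<phi> z) = (\<lambda>z. c * T \<phi> z)) \<and>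
     (\<forall>\<phi>\<in>V. \<forall>\<psi>\<in>V. ipW (T \<phi>) (T \<psi>) = ipV \<phi> \<psi>)"

text \<open>The complex-valued Poisson measure \<open>exp (- \<zeta>) * (\<Sum>n. \<zeta> ^ n / n! * \<delta>\<^sub>n)\<close> on the natural
  numbers, as a set function; \<open>indicator A n\<close> is the Dirac measure \<open>\<delta>\<^sub>n\<close> evaluated at \<open>A\<close>.\<close>

definition poisson_measure :: "complex \<Rightarrow> nat set \<Rightarrow> complex" where
  "poisson_measure \<zeta> A = exp (- \<zeta>) * (\<Sum>n. \<zeta> ^ n / fact n * indicator A n)"

text \<open>Integration against a complex measure \<open>\<mu>\<close> on all subsets of the natural numbers: \<open>\<mu>\<close> has
  density \<open>n \<mapsto> \<mu> {n}\<close> with respect to counting measure, and its total variation has density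
  \<open>n \<mapsto> cmod (\<mu> {n})\<close>.\<close>

definition cmeasure_integrable :: "(nat set \<Rightarrow> complex) \<Rightarrow> (nat \<Rightarrow> complex) \<Rightarrow> bool" where
  "cmeasure_integrable \<mu> g \<longleftrightarrow> integrable (count_space UNIV) (\<lambda>n. g n * \<mu> {n})"

definition cmeasure_integral :: "(nat set \<Rightarrow> complex) \<Rightarrow> (nat \<Rightarrow> complex) \<Rightarrow> complex" where
  "cmeasure_integral \<mu> g = (\<integral>n. g n * \<mu> {n} \<partial>count_space UNIV)"

end

theory Submission
  imports Defs
begin

text \<open>The inner products with the basis functions recover the coefficients of an expansion, so
  unitarity forces \<open>T\<close> to carry \<open>\<Sum>n. f n * (z | \<beta>)\<^sub>n\<close> to \<open>\<Sum>n. f n * z ^ n\<close>. At \<open>\<beta> * m\<close> the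
  generalized falling factorial \<open>(\<beta> * m | \<beta>)\<^sub>n\<close> equals \<open>\<beta> ^ n * m! / (m - n)!\<close> and vanishes for
  \<open>n > m\<close>; hence the Poisson integral, without its factor \<open>exp (- z / \<beta>)\<close>, is the Cauchy product of
  \<open>\<Sum>n. f n * z ^ n\<close> with the exponential series of \<open>z / \<beta>\<close>. Both converge absolutely.\<close>

text \<open>Makes the definite description in \<open>expansion_coeff\<close> computable. It is a
  separate predicate because the two bases satisfy it for different reasons: Taylor coefficients for
  one, evaluation on a lattice for the other.\<close>

definition unique_coeffs ::
  "complex set \<Rightarrow> (nat \<Rightarrow> complex \<Rightarrow> complex) \<Rightarrow> (nat \<Rightarrow> real) \<Rightarrow> bool" where
  "unique_coeffs D e w \<longleftrightarrow>
     (\<forall>\<phi> f g. has_expansion D e w \<phi> f \<longrightarrow> has_expansion D e w \<phi> g \<longrightarrow> f = g)"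

lemma expansion_coeff_eq:
  assumes "unique_coeffs D e w" "has_expansion D e w \<phi> f"
  shows "expansion_coeff D e w \<phi> = f"
  unfolding expansion_coeff_def using assms unfolding unique_coeffs_def by blast

lemma has_expansion_basis:
  assumes "\<And>z. z \<in> D \<Longrightarrow> \<phi> z = e k z"
  shows "has_expansion D e w \<phi> (\<lambda>n. if n = k then 1 else 0)"
  unfolding has_expansion_def
proof
  show "summable (\<lambda>n. (cmod (if n = k then 1 else 0))\<^sup>2 * w n)"
    by (rule summable_finite[of "{k}"]) auto
  show "\<forall>z\<in>D. (\<lambda>n. (if n = k then 1 else 0) * e n z) sums \<phi> z"
  proof
    fix z assume "z \<in> D"
    then show "(\<lambda>n. (if n = k then 1 else 0) * e n z) sums \<phi> z"
      using sums_finite[of "{k}" "\<lambda>n. (if n = k then 1 else 0) * e n z"] assms by auto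
  qed
qed

text \<open>The coefficients of \<open>\<psi>\<close> form a unit vector, so only one term of the
  series survives. Asking for agreement on \<open>D\<close> alone covers both a zero-extended basis
  function and its image under \<open>T\<close>.\<close>

lemma expansion_inner_basis:
  assumes "unique_coeffs D e w" "has_expansion D e w \<phi> f"
    and "\<And>z. z \<in> D \<Longrightarrow> \<psi> z = e k z"
  shows "expansion_inner D e w \<phi> \<psi> = f k * of_real (w k)"
proof -
  have \<psi>: "expansion_coeff D e w \<psi> = (\<lambda>n. if n = k then 1 else 0)"
    using expansion_coeff_eq[OF assms(1) has_expansion_basis, of \<psi> k] assms(3) by blast
  show ?thesis
    unfolding expansion_inner_def expansion_coeff_eq[OF assms(1,2)] \<psi>
    by (subst suminf_finite[of "{k}"]) auto
qed

text \<open>Both sequences consist of the Taylor coefficients of \<open>\<phi>\<close> at 0.\<close>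

lemma unique_coeffs_power: "unique_coeffs UNIV (\<lambda>n z. z ^ n) w"
  unfolding unique_coeffs_def
proof (intro allI impI)
  fix \<phi> f g
  assume "has_expansion UNIV (\<lambda>n z. z ^ n) w \<phi> f" "has_expansion UNIV (\<lambda>n z. z ^ n) w \<phi> g"
  then have "\<phi> has_fps_expansion Abs_fps f" "\<phi> has_fps_expansion Abs_fps g"
    by (auto intro!: has_fps_expansionI simp: has_expansion_def)
  from this[THEN fps_nth_fps_expansion] show "f = g"
    by (simp add: fun_eq_iff)
qed

lemma gen_ffact_mult_of_nat:
  fixes \<beta> :: "'a::field_char_0"
  shows "gen_ffact (\<beta> * of_nat m) \<beta> n = (if n \<le> m then \<beta> ^ n * fact m / fact (m - n) else 0)"
proof (induction n)
  case 0
  then show ?case by (simp add: gen_ffact_def)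
next
  case (Suc n)
  have step: "gen_ffact (\<beta> * of_nat m) \<beta> (Suc n) =
      gen_ffact (\<beta> * of_nat m) \<beta> n * (\<beta> * (of_nat m - of_nat n))"
    by (simp add: gen_ffact_def algebra_simps)
  show ?case
  proof (cases "n < m")
    case True
    \<comment> \<open>The new factor cancels the leading factor of
      \<open>fact (m - n)\<close>.\<close>
    then have "fact (m - n) = (of_nat m - of_nat n) * (fact (m - Suc n) :: 'a)"
      by (simp add: of_nat_diff flip: Suc_diff_Suc)
    moreover have "of_nat m - of_nat n \<noteq> (0 :: 'a)"
      using True by simp
    ultimately show ?thesis
      using True by (simp add: step Suc.IH)
  \<comment> \<open>For \<open>n = m\<close> the new factor is zero; for \<open>n > m\<close> the
    product has already vanished.\<close>
  qed (use step Suc.IH in auto)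
qed

lemma sums_gen_ffact_mult_of_nat:
  fixes \<beta> :: complex
  shows "(\<lambda>n. f n * gen_ffact (\<beta> * of_nat m) \<beta> n) sums
           (\<Sum>n\<le>m. f n * (\<beta> ^ n * fact m / fact (m - n)))"
  using sums_finite[of "{..m}" "\<lambda>n. f n * gen_ffact (\<beta> * of_nat m) \<beta> n"]
  by (simp add: gen_ffact_mult_of_nat)

text \<open>Used twice: it determines the coefficients from the values of \<open>\<phi>\<close>, and
  it supplies the integrand of the Poisson integral.\<close>

lemma has_expansion_gen_ffact_of_nat:
  assumes "has_expansion D (\<lambda>n z. gen_ffact z \<beta> n) w \<phi> f" "\<beta> * of_nat m \<in> D"
  shows "\<phi> (\<beta> * of_nat m) = (\<Sum>n\<le>m. f n * (\<beta> ^ n * fact m / fact (m - n)))"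
  using assms sums_gen_ffact_mult_of_nat unfolding has_expansion_def by (blast dest: sums_unique2)

text \<open>Evaluating at \<open>\<beta> * m\<close> gives a triangular system for the coefficients.\<close>

lemma unique_coeffs_gen_ffact:
  assumes "\<beta> \<noteq> 0" "\<And>m. \<beta> * of_nat m \<in> D"
  shows "unique_coeffs D (\<lambda>n z. gen_ffact z \<beta> n) w"
  unfolding unique_coeffs_def
proof (intro allI impI ext)
  fix \<phi> f g m
  assume f: "has_expansion D (\<lambda>n z. gen_ffact z \<beta> n) w \<phi> f"
    and g: "has_expansion D (\<lambda>n z. gen_ffact z \<beta> n) w \<phi> g"
  show "f m = g m"
  proof (induction m rule: less_induct)
    case (less m)
    have "(\<Sum>n\<le>m. f n * (\<beta> ^ n * fact m / fact (m - n))) =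
        (\<Sum>n\<le>m. g n * (\<beta> ^ n * fact m / fact (m - n)))"
      using has_expansion_gen_ffact_of_nat[OF f assms(2)]
        has_expansion_gen_ffact_of_nat[OF g assms(2)] by metis
    moreover have "(\<Sum>n<m. f n * (\<beta> ^ n * fact m / fact (m - n))) =
        (\<Sum>n<m. g n * (\<beta> ^ n * fact m / fact (m - n)))"
      using less by (intro sum.cong) auto
    \<comment> \<open>Only the diagonal terms remain, and their common factor
      \<open>\<beta> ^ m * fact m\<close> is nonzero.\<close>
    ultimately show ?case
      using assms(1) by (simp add: lessThan_Suc_atMost[symmetric])
  qed
qed

lemma zero_ext_gen_ffact_in_expansion_space:
  "zero_ext D (\<lambda>z. gen_ffact z \<beta> n) \<in> expansion_space D (\<lambda>n z. gen_ffact z \<beta> n) w"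
proof -
  have "(\<lambda>z. gen_ffact z \<beta> n) holomorphic_on D"
    unfolding gen_ffact_def by (intro holomorphic_intros)
  then have "zero_ext D (\<lambda>z. gen_ffact z \<beta> n) holomorphic_on D"
    by (rule holomorphic_transform) (simp add: zero_ext_def)
  moreover have "has_expansion D (\<lambda>n z. gen_ffact z \<beta> n) w
      (zero_ext D (\<lambda>z. gen_ffact z \<beta> n)) (\<lambda>k. if k = n then 1 else 0)"
    by (rule has_expansion_basis) (simp add: zero_ext_def)
  ultimately show ?thesis
    unfolding expansion_space_def zero_ext_def by auto
qed

text \<open>The step \<open>- \<eta>\<close> turns the factors into
  \<open>\<sigma> + k * \<eta>\<close>. Positivity later allows the weight to be cancelled.\<close>

lemma weight_pos:
  assumes "\<eta> \<ge> 0" "\<sigma> > 0"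
  shows "weight \<eta> \<sigma> n > 0"
  unfolding weight_def gen_ffact_def
  using assms by (intro mult_pos_pos prod_pos) (auto intro: add_pos_nonneg)

lemma admissible_sigma_pos: "admissible \<alpha> \<beta> \<sigma> \<Longrightarrow> \<sigma> > 0"
  by (simp add: admissible_def)

lemma admissible_beta_nonzero: "admissible \<alpha> \<beta> \<sigma> \<Longrightarrow> \<beta> \<noteq> 0"
  by (auto simp: admissible_def)

lemma admissible_eta_nonneg: "admissible \<alpha> \<beta> \<sigma> \<Longrightarrow> eta \<alpha> \<beta> \<ge> 0"
  by (auto simp: admissible_def eta_def complex_is_Real_iff)

text \<open>On the lattice the real part in the half-plane condition is a nonnegative multiple of
  \<open>eta \<alpha> \<beta>\<close>, hence above \<open>- \<sigma> / 2\<close>.\<close>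

lemma beta_of_nat_in_D_dom:
  assumes "admissible \<alpha> \<beta> \<sigma>"
  shows "\<beta> * of_nat m \<in> D_dom \<alpha> \<beta> \<sigma>"
proof -
  have "Re (\<alpha> * (\<beta> * of_nat m)) = eta \<alpha> \<beta> * of_nat m"
    by (simp add: eta_def algebra_simps)
  also have "\<dots> \<ge> 0"
    using admissible_eta_nonneg[OF assms] by simp
  finally show ?thesis
    using admissible_sigma_pos[OF assms] unfolding D_dom_def by auto
qed

lemma poisson_measure_singleton:
  "poisson_measure \<zeta> {m} = exp (- \<zeta>) * (\<zeta> ^ m / fact m)"
  unfolding poisson_measure_def by (subst suminf_finite[of "{m}"]) auto

lemma poisson_integral_gen_ffact_series:
  assumes "\<beta> \<noteq> 0" and summable: "summable (\<lambda>n. norm (f n * z ^ n))"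
    and h: "\<And>m. h m = (\<Sum>n\<le>m. f n * (\<beta> ^ n * fact m / fact (m - n)))"
  shows "cmeasure_integrable (poisson_measure (z / \<beta>)) h"
    and "cmeasure_integral (poisson_measure (z / \<beta>)) h = (\<Sum>n. f n * z ^ n)"
proof -
  define \<zeta> where "\<zeta> = z / \<beta>"
  define a where "a n = f n * z ^ n" for n
  define b where "b n = \<zeta> ^ n / fact n" for n
  have a: "summable (\<lambda>n. norm (a n))"
    using summable by (simp add: a_def)
  have b: "summable (\<lambda>n. norm (b n))"
    using summable_norm_exp[of \<zeta>] by (simp add: b_def scaleR_conv_of_real divide_inverse mult.commute)
  have b_sum: "(\<Sum>n. b n) = exp \<zeta>"
    by (simp add: b_def exp_def scaleR_conv_of_real divide_inverse mult.commute)
  have density: "h m * poisson_measure \<zeta> {m} = exp (- \<zeta>) * (\<Sum>n\<le>m. a n * b (m - n))" for m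
  proof -
    \<comment> \<open>The factor \<open>fact m\<close> cancels, and \<open>\<zeta> ^ m\<close>
      splits so that \<open>\<beta> ^ n * \<zeta> ^ n\<close> becomes \<open>z ^ n\<close>.\<close>
    have "f n * (\<beta> ^ n * fact m / fact (m - n)) * (\<zeta> ^ m / fact m) = a n * b (m - n)"
      if "n \<le> m" for n
    proof -
      have "\<zeta> ^ m = \<zeta> ^ n * \<zeta> ^ (m - n)"
        using that by (simp flip: power_add)
      moreover have "z ^ n = \<beta> ^ n * \<zeta> ^ n"
        using assms(1) by (simp add: \<zeta>_def power_divide)
      ultimately show ?thesis
        by (simp add: a_def b_def)
    qed
    then have "h m * (\<zeta> ^ m / fact m) = (\<Sum>n\<le>m. a n * b (m - n))"
      unfolding h sum_distrib_right by (intro sum.cong) auto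
    then show ?thesis
      unfolding poisson_measure_singleton by (metis mult.left_commute)
  qed
  \<comment> \<open>Integrability over counting measure means absolute summability; the Cauchy
    product of the two series of norms is a majorant.\<close>
  have "summable (\<lambda>m. norm (\<Sum>n\<le>m. a n * b (m - n)))"
  proof (rule summable_comparison_test')
    show "summable (\<lambda>m. \<Sum>n\<le>m. norm (a n) * norm (b (m - n)))"
      using a b by (intro summable_Cauchy_product) auto
    show "norm (norm (\<Sum>n\<le>m. a n * b (m - n))) \<le> (\<Sum>n\<le>m. norm (a n) * norm (b (m - n)))"
      if "m \<ge> 0" for m
      by (auto intro!: sum_norm_le simp: norm_mult)
  qed
  then show integrable: "cmeasure_integrable (poisson_measure (z / \<beta>)) h"
    unfolding cmeasure_integrable_def \<zeta>_def[symmetric] density integrable_count_space_nat_iff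
    by (simp add: norm_mult summable_mult)
  have "cmeasure_integral (poisson_measure \<zeta>) h = (\<Sum>m. exp (- \<zeta>) * (\<Sum>n\<le>m. a n * b (m - n)))"
    using integrable
    unfolding cmeasure_integral_def cmeasure_integrable_def \<zeta>_def[symmetric] density
    by (rule integral_count_space_nat)
  also have "\<dots> = exp (- \<zeta>) * ((\<Sum>n. a n) * (\<Sum>n. b n))"
    using Cauchy_product_sums[OF a b] by (intro sums_unique[symmetric] sums_mult)
  finally show "cmeasure_integral (poisson_measure (z / \<beta>)) h = (\<Sum>n. f n * z ^ n)"
    by (simp add: b_sum exp_minus a_def \<zeta>_def)
qed

theorem lemma3p11:
  fixes \<alpha> \<beta> :: complex and \<sigma> :: real
    and T :: "(complex \<Rightarrow> complex) \<Rightarrow> complex \<Rightarrow> complex"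
  assumes "admissible \<alpha> \<beta> \<sigma>"
    and "unitary_operator (F_space \<alpha> \<beta> \<sigma>) (F_inner \<alpha> \<beta> \<sigma>)
           (Fock_space (eta \<alpha> \<beta>) \<sigma>) (Fock_inner (eta \<alpha> \<beta>) \<sigma>) T"
    and "\<And>n z. T (zero_ext (D_dom \<alpha> \<beta> \<sigma>) (\<lambda>w. gen_ffact w \<beta> n)) z = z ^ n"
  shows "\<forall>f\<in>F_space \<alpha> \<beta> \<sigma>. \<forall>z.
           cmeasure_integrable (poisson_measure (z / \<beta>)) (\<lambda>\<xi>. f (\<beta> * of_nat \<xi>)) \<and>
           T f z = cmeasure_integral (poisson_measure (z / \<beta>)) (\<lambda>\<xi>. f (\<beta> * of_nat \<xi>))"
proof (intro ballI allI)
  fix \<phi> and z :: complex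
  assume \<phi>: "\<phi> \<in> F_space \<alpha> \<beta> \<sigma>"
  let ?D = "D_dom \<alpha> \<beta> \<sigma>" and ?w = "weight (eta \<alpha> \<beta>) \<sigma>"
  note \<beta> = admissible_beta_nonzero[OF assms(1)]
  note dom = beta_of_nat_in_D_dom[OF assms(1)]
  from \<phi> obtain f where f: "has_expansion ?D (\<lambda>n z. gen_ffact z \<beta> n) ?w \<phi> f"
    unfolding F_space_def expansion_space_def by auto
  from \<phi> assms(2) have "T \<phi> \<in> Fock_space (eta \<alpha> \<beta>) \<sigma>"
    unfolding unitary_operator_def by blast
  then obtain g where g: "has_expansion UNIV (\<lambda>n z. z ^ n) ?w (T \<phi>) g"
    unfolding Fock_space_def expansion_space_def by auto
  have "f = g"
  proof
    fix k
    let ?e = "zero_ext ?D (\<lambda>z. gen_ffact z \<beta> k)"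
    have "?e \<in> F_space \<alpha> \<beta> \<sigma>"
      unfolding F_space_def by (rule zero_ext_gen_ffact_in_expansion_space)
    with \<phi> assms(2) have "Fock_inner (eta \<alpha> \<beta>) \<sigma> (T \<phi>) (T ?e) = F_inner \<alpha> \<beta> \<sigma> \<phi> ?e"
      unfolding unitary_operator_def by blast
    moreover have "F_inner \<alpha> \<beta> \<sigma> \<phi> ?e = f k * of_real (?w k)"
      unfolding F_inner_def
      by (rule expansion_inner_basis[OF unique_coeffs_gen_ffact[OF \<beta> dom] f])
        (simp add: zero_ext_def)
    \<comment> \<open>The assumed values of \<open>T ?e\<close> are those of the monomial
      \<open>z ^ k\<close>, so this pairing reads off \<open>g k\<close> with the same
      weight.\<close>
    moreover have "Fock_inner (eta \<alpha> \<beta>) \<sigma> (T \<phi>) (T ?e) = g k * of_real (?w k)"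
      unfolding Fock_inner_def
      by (rule expansion_inner_basis[OF unique_coeffs_power g]) (rule assms(3))
    moreover have "?w k > 0"
      using admissible_eta_nonneg[OF assms(1)] admissible_sigma_pos[OF assms(1)]
      by (rule weight_pos)
    ultimately show "f k = g k" by simp
  qed
  with g have sums: "(\<lambda>n. f n * z ^ n) sums T \<phi> z" for z
    unfolding has_expansion_def by blast
  \<comment> \<open>The power series converges at every point; convergence at one of modulus greater
    than \<open>norm z\<close> gives absolute convergence at \<open>z\<close>.\<close>
  have "norm z < norm (of_real (norm z + 1) :: complex)"
    by (simp only: norm_of_real)
  then have "summable (\<lambda>n. norm (f n * z ^ n))"
    using sums_summable[OF sums] powser_insidea by blast
  from poisson_integral_gen_ffact_series[OF \<beta> this has_expansion_gen_ffact_of_nat[OF f dom]]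
  show "cmeasure_integrable (poisson_measure (z / \<beta>)) (\<lambda>\<xi>. \<phi> (\<beta> * of_nat \<xi>)) \<and>
      T \<phi> z = cmeasure_integral (poisson_measure (z / \<beta>)) (\<lambda>\<xi>. \<phi> (\<beta> * of_nat \<xi>))"
    using sums_unique[OF sums] by simp
qed

end
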